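(* Let $r\ge 3$ and $k\ge 2$ be integers, and let $t=(r-1)(k-1)+1$. Let $n\ge 1$ be an integer with $t\mid n$, and assume that a Steiner system $S(2,r,t)$ exists. Then for every linear $r$-uniform hypertree $T_k^r$ with $k$ hyperedges, $$ex_r^{\mathrm{lin}}(n,T_k^r)\ge \frac{n(k-1)}{r}.$$ This bound is sharp when $T_k^r$ is the star $S_k^r$, i.e. whenever $r\ge 3$, $k\ge 2$ and $n\ge 1$ are integers such that $(r-1)(k-1)+1$ divides $n$ and a Steiner system $S(2,r,(r-1)(k-1)+1)$ exists, one has $ex_r^{\mathrm{lin}}(n,S_k^r)=\frac{n(k-1)}{r}$.
   Context: All hypergraphs are finite. A hypergraph is $r$-uniform if each hyperedge has exactly $r$ vertices, and linear if any two distinct hyperedges intersect in at most one vertex. A linear $r$-uniform hypertree $T_k^r$ on $k$ hyperedges is a connected, acyclic, linear $r$-uniform hypergraph with exactly $k$ hyperedges; here acyclic means that there is no sequence of distinct hyperedges $e_1,\dots,e_s$ with $s\ge 3$ such that $e_i\cap e_{i+1}\ne\emptyset$ for all $i$ (indices modulo $s$) and all these intersections are distinct. $S_k^r$ is the $r$-uniform linear star: $k$ hyperedges of size $r$ sharing one common vertex and otherwise pairwise disjoint. A hypergraph $H$ contains $F$ as a subhypergraph if there is an injective map $V(F)\to V(H)$ sending every hyperedge of $F$ to a hyperedge of $H$; otherwise $H$ is $F$-free. The linear Turán number $ex_r^{\mathrm{lin}}(n,F)$ is the maximum number of hyperedges in an $F$-free linear $r$-uniform hypergraph on $n$ vertices.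 A Steiner system $S(2,r,m)$ is a set of $m$ vertices together with a family of $r$-element subsets (blocks, viewed as hyperedges) such that every pair of distinct vertices lies in exactly one block. *)

theory Defs
  imports Complex_Main
begin

record 'a hypergraph =
  verts :: "'a set"
  edges :: "'a set set"

definition hypergraph :: "'a hypergraph \<Rightarrow> bool" where
  "hypergraph H \<longleftrightarrow> finite (verts H) \<and> (\<forall>e\<in>edges H. e \<subseteq> verts H)"

definition uniform_hypergraph :: "nat \<Rightarrow> 'a hypergraph \<Rightarrow> bool" where
  "uniform_hypergraph r H \<longleftrightarrow> (\<forall>e\<in>edges H. card e = r)"

definition linear_hypergraph :: "'a hypergraph \<Rightarrow> bool" where
  "linear_hypergraph H \<longleftrightarrow> (\<forall>e\<in>edges H. \<forall>f\<in>edges H. e \<noteq> f \<longrightarrow> card (e \<inter> f) \<le> 1)"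

definition connected_hypergraph :: "'a hypergraph \<Rightarrow> bool" where
  "connected_hypergraph H \<longleftrightarrow>
     (\<forall>u\<in>verts H. \<forall>v\<in>verts H. (u, v) \<in> {(x, y). \<exists>e\<in>edges H. x \<in> e \<and> y \<in> e}\<^sup>*)"

text \<open>
  A cycle is a cyclic sequence of at least three distinct hyperedges whose consecutive
  intersections are nonempty and pairwise distinct as sets.
\<close>

definition hypercycle :: "'a hypergraph \<Rightarrow> 'a set list \<Rightarrow> bool" where
  "hypercycle H es \<longleftrightarrow>
     3 \<le> length es \<and> distinct es \<and> set es \<subseteq> edges H \<and>
     (\<forall>i<length es. es ! i \<inter> es ! (Suc i mod length es) \<noteq> {}) \<and>
     inj_on (\<lambda>i. es ! i \<inter> es ! (Suc i mod length es)) {..<length es}"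

definition acyclic_hypergraph :: "'a hypergraph \<Rightarrow> bool" where
  "acyclic_hypergraph H \<longleftrightarrow> (\<nexists>es. hypercycle H es)"

definition linear_hypertree :: "nat \<Rightarrow> nat \<Rightarrow> 'a hypergraph \<Rightarrow> bool" where
  "linear_hypertree r k T \<longleftrightarrow>
     hypergraph T \<and> uniform_hypergraph r T \<and> linear_hypergraph T \<and>
     connected_hypergraph T \<and> acyclic_hypergraph T \<and> card (edges T) = k"

text \<open>
  Stars are described up to isomorphism. The equation for the vertex set excludes
  isolated vertices.
\<close>

definition linear_star :: "nat \<Rightarrow> nat \<Rightarrow> 'a hypergraph \<Rightarrow> bool" where
  "linear_star r k S \<longleftrightarrow>
     hypergraph S \<and> uniform_hypergraph r S \<and> card (edges S) = k \<and> verts S = \<Union>(edges S) \<and>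
     (\<exists>c. (\<forall>e\<in>edges S. c \<in> e) \<and>
          (\<forall>e\<in>edges S. \<forall>f\<in>edges S. e \<noteq> f \<longrightarrow> e \<inter> f = {c}))"

definition contains_hypergraph :: "'b hypergraph \<Rightarrow> 'a hypergraph \<Rightarrow> bool" where
  "contains_hypergraph H F \<longleftrightarrow>
     (\<exists>\<phi>. inj_on \<phi> (verts F) \<and> \<phi> ` verts F \<subseteq> verts H \<and> (\<forall>e\<in>edges F. \<phi> ` e \<in> edges H))"

text \<open>
  The host hypergraphs have natural numbers as vertices, which loses no generality since
  they are finite. The set below is finite, and it is nonempty whenever \<open>F\<close> has a hyperedge,
  because then the edgeless hypergraph is \<open>F\<close>-free.
\<close>

definition ex_lin :: "nat \<Rightarrow> nat \<Rightarrow> 'a hypergraph \<Rightarrow> nat" where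
  "ex_lin r n F =
     Max {card (edges H) | H :: nat hypergraph.
            hypergraph H \<and> uniform_hypergraph r H \<and> linear_hypergraph H \<and> card (verts H) = n \<and>
            \<not> contains_hypergraph H F}"

text \<open>Steiner systems $S(2,r,m)$.\<close>

definition steiner_system2 :: "nat \<Rightarrow> nat \<Rightarrow> 'a hypergraph \<Rightarrow> bool" where
  "steiner_system2 r m B \<longleftrightarrow>
     hypergraph B \<and> card (verts B) = m \<and> uniform_hypergraph r B \<and>
     (\<forall>u\<in>verts B. \<forall>v\<in>verts B. u \<noteq> v \<longrightarrow> (\<exists>!b. b \<in> edges B \<and> u \<in> b \<and> v \<in> b))"

end

theory Submission
  imports Defs
begin

text \<open>
  For the lower bound take \<open>n / t\<close> disjoint copies of the Steiner system. A hypertree with \<open>k\<close>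
  hyperedges has at least \<open>k (r - 1) + 1 > t\<close> vertices, since attaching hyperedges one at a time
  each new one meets the union of the previous ones in a single vertex (two such vertices and
  a shortest path between them would give a cycle). As it is connected, it would have to embed
  into a single copy, which has only \<open>t\<close> vertices. For the upper bound, a vertex of degree at
  least \<open>k\<close> in a linear hypergraph is the centre of a star, so in a star-free hypergraph the
  degree sum \<open>r |E|\<close> is at most \<open>n (k - 1)\<close>.
\<close>

section \<open>Adjacency and shortest walks\<close>

text \<open>The adjacency relation inside \<open>connected_hypergraph\<close>, taken over an
  arbitrary family of hyperedges so that connectivity can be stated for subfamilies of a
  hypertree.\<close>

definition joined :: "'a set set \<Rightarrow> ('a \<times> 'a) set" where
  "joined C = {(x, y). \<exists>e\<in>C. x \<in> e \<and> y \<in> e}"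

lemma joined_mono: "C \<subseteq> D \<Longrightarrow> joined C \<subseteq> joined D"
  by (auto simp: joined_def)

lemma connected_hypergraph_joined:
  "connected_hypergraph H \<longleftrightarrow> (\<forall>u\<in>verts H. \<forall>v\<in>verts H. (u, v) \<in> (joined (edges H))\<^sup>*)"
  by (simp add: connected_hypergraph_def joined_def)

lemma relpow_funI:
  assumes "\<And>i. i < L \<Longrightarrow> (v i, v (Suc i)) \<in> R" "i \<le> j" "j \<le> L"
  shows "(v i, v j) \<in> R ^^ (j - i)"
  unfolding relpow_fun_conv using assms by (intro exI[of _ "\<lambda>l. v (i + l)"]) auto

text \<open>A walk of least length works: a repeated vertex or a chord from \<open>v i\<close> to
  some \<open>v j\<close> with \<open>j > Suc i\<close> would shorten it. Absence of chords later
  forces the hyperedges along the walk to be distinct.\<close>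

lemma shortest_walk:
  assumes "(x, y) \<in> R\<^sup>*"
  obtains v L where "v 0 = x" "v L = y" "\<And>i. i < L \<Longrightarrow> (v i, v (Suc i)) \<in> R"
    "inj_on v {..L}" "\<And>i j. i < j \<Longrightarrow> j \<le> L \<Longrightarrow> (v i, v j) \<in> R \<Longrightarrow> j = Suc i"
proof -
  obtain L where L: "(x, y) \<in> R ^^ L" and least: "\<And>l. (x, y) \<in> R ^^ l \<Longrightarrow> L \<le> l"
    using ex_has_least_nat[of "\<lambda>l. (x, y) \<in> R ^^ l" _ id] assms
    by (metis id_apply rtrancl_imp_UN_relpow UN_E)
  obtain v where v: "v 0 = x" "v L = y" "\<And>i. i < L \<Longrightarrow> (v i, v (Suc i)) \<in> R"
    using L unfolding relpow_fun_conv by auto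
  have pre: "(x, v i) \<in> R ^^ i" if "i \<le> L" for i
    using relpow_funI[of L v R 0 i] v that by auto
  have post: "(v j, y) \<in> R ^^ (L - j)" if "j \<le> L" for j
    using relpow_funI[of L v R j L] v that by auto
  have "v i \<noteq> v j" if "i < j" "j \<le> L" for i j
  proof
    assume eq: "v i = v j"
    \<comment> \<open>Cut out the closed segment between positions \<open>i\<close> and
      \<open>j\<close>.\<close>
    have "(x, y) \<in> R ^^ (i + (L - j))"
      unfolding relpow_add using pre[of i] post[of j] that eq by auto
    from least[OF this] that show False by simp
  qed
  then have inj: "inj_on v {..L}"
    by (metis atMost_iff inj_onI linorder_neqE_nat)
  have "j = Suc i" if "i < j" "j \<le> L" "(v i, v j) \<in> R" for i j
  proof -
    \<comment> \<open>Reach \<open>v i\<close> in \<open>i\<close> steps, then jump to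
      \<open>v j\<close>; minimality of \<open>L\<close> leaves no room for
      \<open>j > Suc i\<close>.\<close>
    have "(x, v j) \<in> R ^^ Suc i" using pre[of i] that by auto
    then have "(x, y) \<in> R ^^ (Suc i + (L - j))"
      unfolding relpow_add[of "Suc i"] using post[of j] that by blast
    from least[OF this] that show ?thesis by simp
  qed
  with v inj that show ?thesis by blast
qed

section \<open>Counting the vertices of a hypertree\<close>

lemma linear_inter_singleton:
  assumes "linear_hypergraph H" "e \<in> edges H" "f \<in> edges H" "e \<noteq> f" "finite e" "v \<in> e" "v \<in> f"
  shows "e \<inter> f = {v}"
proof -
  have "card (e \<inter> f) \<le> 1" using assms by (auto simp: linear_hypergraph_def)
  \<comment> \<open>Finiteness matters here: an infinite intersection has \<open>card\<close> 0 and
    would also satisfy the bound.\<close>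
  then show ?thesis using assms card_le_Suc0_iff_eq[of "e \<inter> f"] by auto
qed

text \<open>If \<open>e\<close> met the connected family \<open>C\<close> in two vertices, a
  shortest walk between them through \<open>C\<close>, closed up by \<open>e\<close>, would be a
  hypercycle.\<close>

lemma acyclic_attach:
  assumes lin: "linear_hypergraph H" and fin: "\<And>f. f \<in> edges H \<Longrightarrow> finite f"
    and acy: "acyclic_hypergraph H"
    and C: "C \<subseteq> edges H" and conn: "\<And>x y. x \<in> \<Union>C \<Longrightarrow> y \<in> \<Union>C \<Longrightarrow> (x, y) \<in> (joined C)\<^sup>*"
    and e: "e \<in> edges H" "e \<notin> C"
    and x: "x \<in> e \<inter> \<Union>C" and y: "y \<in> e \<inter> \<Union>C"
  shows "x = y"
proof (rule ccontr)
  assume "x \<noteq> y"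
  obtain v L where v: "v 0 = x" "v L = y" "\<And>i. i < L \<Longrightarrow> (v i, v (Suc i)) \<in> joined C"
    "inj_on v {..L}" "\<And>i j. i < j \<Longrightarrow> j \<le> L \<Longrightarrow> (v i, v j) \<in> joined C \<Longrightarrow> j = Suc i"
    using shortest_walk conn[of x y] x y by (metis IntE)
  have "\<forall>i. \<exists>g. i < L \<longrightarrow> g \<in> C \<and> v i \<in> g \<and> v (Suc i) \<in> g"
    using v(3) by (auto simp: joined_def)
  then obtain g where g: "\<And>i. i < L \<Longrightarrow> g i \<in> C \<and> v i \<in> g i \<and> v (Suc i) \<in> g i"
    by metis
  have "L \<noteq> 0" using v \<open>x \<noteq> y\<close> by metis
  \<comment> \<open>A walk of length 1 would put \<open>x\<close> and \<open>y\<close> into two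
    different hyperedges, against linearity. Hence the closed sequence below has at least 3
    hyperedges.\<close>
  have "L \<noteq> 1"
  proof
    assume "L = 1"
    then have "g 0 \<in> C" "x \<in> g 0" "y \<in> g 0" using g[of 0] v by auto
    then have "e \<inter> g 0 = {x}" "y \<in> e \<inter> g 0"
      using linear_inter_singleton[OF lin e(1), of "g 0" x] fin e C x y by auto
    then show False using \<open>x \<noteq> y\<close> by auto
  qed
  with \<open>L \<noteq> 0\<close> have L: "2 \<le> L" by simp
  \<comment> \<open>Equal hyperedges would contain both \<open>v i\<close> and
    \<open>v (Suc j)\<close>, a chord of the walk.\<close>
  have g_neq: "g i \<noteq> g j" if "i < j" "j < L" for i j
  proof
    assume "g i = g j"
    then have "(v i, v (Suc j)) \<in> joined C"
      using g[of i] g[of j] that by (auto simp: joined_def)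
    from v(5)[OF _ _ this] that show False by simp
  qed
  \<comment> \<open>With \<open>e\<close> in front, positions \<open>i\<close> and
    \<open>i + 1\<close> share exactly \<open>v i\<close>: \<open>e\<close> and \<open>g 0\<close>
    share \<open>v 0 = x\<close>, and at the wrap-around \<open>g (L - 1)\<close> and
    \<open>e\<close> share \<open>v L = y\<close>. Injectivity of \<open>v\<close> then makes the
    intersections distinct.\<close>
  define es where "es = e # map g [0..<L]"
  have len: "length es = Suc L" by (simp add: es_def)
  have inj_g: "inj_on g {..<L}"
    by (metis g_neq inj_onI lessThan_iff linorder_neqE_nat)
  have dist: "distinct es"
    unfolding es_def using inj_g g e by (auto simp: distinct_map atLeast0LessThan)
  have sub: "set es \<subseteq> edges H" unfolding es_def using g e C by auto
  have nth: "es ! Suc i = g i" if "i < L" for i using that by (simp add: es_def)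
  have nth0: "es ! 0 = e" by (simp add: es_def)
  have inter: "es ! i \<inter> es ! (Suc i mod length es) = {v i}" if "i < length es" for i
  proof -
    have j: "Suc i mod length es < length es" "i \<noteq> Suc i mod length es"
      using that len L by (auto simp: mod_Suc)
    have m1: "v i \<in> es ! i"
      using that g x v nth0 nth len by (cases i) force+
    have m2: "v i \<in> es ! (Suc i mod length es)"
    proof (cases "i = L")
      case True
      then show ?thesis using v y nth0 len by simp
    next
      case False
      then show ?thesis using g[of i] nth[of i] that len by simp
    qed
    show ?thesis
    proof (rule linear_inter_singleton[OF lin _ _ _ _ m1 m2])
      show "es ! i \<in> edges H" "es ! (Suc i mod length es) \<in> edges H"
        using sub nth_mem[OF that] nth_mem[OF j(1)] by auto
      then show "finite (es ! i)" using fin by blast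
      show "es ! i \<noteq> es ! (Suc i mod length es)"
        using nth_eq_iff_index_eq[OF dist that j(1)] j(2) by simp
    qed
  qed
  have "inj_on (\<lambda>i. {v i}) {..<length es}"
    using v(4) len by (auto simp: inj_on_def)
  then have "inj_on (\<lambda>i. es ! i \<inter> es ! (Suc i mod length es)) {..<length es}"
    using inter by (subst inj_on_cong[where g = "\<lambda>i. {v i}"]) auto
  then have "hypercycle H es"
    unfolding hypercycle_def using len L dist sub inter by auto
  with acy show False by (auto simp: acyclic_hypergraph_def)
qed

text \<open>Grow a connected family one hyperedge at a time. Each new hyperedge meets the old union
  in one vertex and so adds \<open>r - 1\<close> vertices. The count starts at
  \<open>Suc m = 1\<close>, since the empty family has no vertex and would break the
  formula.\<close>

lemma hypertree_subtree:
  assumes T: "linear_hypertree r k T" and "1 \<le> r" and "m < k"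
  shows "\<exists>C \<subseteq> edges T. card C = Suc m \<and> card (\<Union>C) = Suc m * (r - 1) + 1 \<and>
           (\<forall>x\<in>\<Union>C. \<forall>y\<in>\<Union>C. (x, y) \<in> (joined C)\<^sup>*)"
  using \<open>m < k\<close>
proof (induction m)
  case 0
  have "card (edges T) = k" using T by (simp add: linear_hypertree_def)
  with 0 obtain e where e: "e \<in> edges T" by fastforce
  then have "card e = r" using T by (simp add: linear_hypertree_def uniform_hypergraph_def)
  then show ?case using e \<open>1 \<le> r\<close>
    by (intro exI[of _ "{e}"]) (auto simp: joined_def)
next
  case (Suc m)
  have hyp: "finite (verts T)" "\<And>e. e \<in> edges T \<Longrightarrow> e \<subseteq> verts T"
    and unif: "\<And>e. e \<in> edges T \<Longrightarrow> card e = r"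
    and lin: "linear_hypergraph T" and acy: "acyclic_hypergraph T"
    and conn: "\<And>u v. u \<in> verts T \<Longrightarrow> v \<in> verts T \<Longrightarrow> (u, v) \<in> (joined (edges T))\<^sup>*"
    and card_T: "card (edges T) = k"
    using T by (auto simp: linear_hypertree_def hypergraph_def uniform_hypergraph_def
        connected_hypergraph_joined)
  have fin: "finite e" if "e \<in> edges T" for e using hyp that by (meson finite_subset)
  obtain C where C: "C \<subseteq> edges T" "card C = Suc m" "card (\<Union>C) = Suc m * (r - 1) + 1"
    and Cconn: "\<And>x y. x \<in> \<Union>C \<Longrightarrow> y \<in> \<Union>C \<Longrightarrow> (x, y) \<in> (joined C)\<^sup>*"
    using Suc.IH Suc_lessD[OF Suc.prems] by metis
  obtain x where x: "x \<in> \<Union>C" using C(3) by (metis card.empty ex_in_conv add_is_0 one_neq_zero)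
  have "C \<noteq> edges T" using C card_T Suc.prems by auto
  then obtain e' where e': "e' \<in> edges T" "e' \<notin> C" using C by auto
  obtain y where y: "y \<in> e'" using unif[OF e'(1)] \<open>1 \<le> r\<close> by (metis card.empty ex_in_conv not_one_le_zero)
  have "\<exists>e\<in>edges T - C. e \<inter> \<Union>C \<noteq> {}"
  proof (rule ccontr)
    assume no: "\<not> ?thesis"
    have "(x, y) \<in> (joined (edges T))\<^sup>*" using conn x y e' C hyp by blast
    then have "y \<in> \<Union>C"
    proof (induction rule: rtrancl_induct)
      case base
      show ?case by (rule x)
    next
      case (step y z)
      then obtain f where "f \<in> edges T" "y \<in> f" "z \<in> f" by (auto simp: joined_def)
      with step.IH no show ?case by blast
    qed
    with no e' y show False by blast
  qed
  then obtain e w where e: "e \<in> edges T" "e \<notin> C" "w \<in> e \<inter> \<Union>C" by blast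
  have inter: "e \<inter> \<Union>C = {w}"
    using acyclic_attach[OF lin fin acy C(1) Cconn e(1,2) _ e(3)] e(3) by blast
  have "finite C" using C(2) by (metis card.infinite nat.distinct(1))
  have "finite (\<Union>C)" using C hyp by (meson Sup_least finite_subset subsetD)
  then have "card (\<Union>(insert e C)) = r + (Suc m * (r - 1) + 1) - 1"
    using card_Un_Int[of e "\<Union>C"] fin[OF e(1)] inter unif[OF e(1)] C(3) by auto
  then have cardU: "card (\<Union>(insert e C)) = Suc (Suc m) * (r - 1) + 1"
    using \<open>1 \<le> r\<close> by (cases r) simp_all
  let ?J = "joined (insert e C)"
  have mono: "(joined C)\<^sup>* \<subseteq> ?J\<^sup>*" by (intro rtrancl_mono joined_mono) auto
  \<comment> \<open>The attaching vertex \<open>w\<close> serves as a hub: everything in the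
    enlarged family is linked to it in both directions.\<close>
  have to_w: "(a, w) \<in> ?J\<^sup>* \<and> (w, a) \<in> ?J\<^sup>*" if "a \<in> \<Union>(insert e C)" for a
  proof (cases "a \<in> e")
    case True
    with e(3) have "(a, w) \<in> ?J" "(w, a) \<in> ?J" by (auto simp: joined_def)
    then show ?thesis by blast
  next
    case False
    with that e(3) Cconn mono show ?thesis by blast
  qed
  have "card (insert e C) = Suc (Suc m)" using \<open>finite C\<close> e C by simp
  moreover have "insert e C \<subseteq> edges T" using e C by simp
  moreover have "\<forall>x\<in>\<Union>(insert e C). \<forall>y\<in>\<Union>(insert e C). (x, y) \<in> ?J\<^sup>*"
    using to_w rtrancl_trans by meson
  ultimately show ?case using cardU by blast
qed

lemma hypertree_card_verts:
  assumes T: "linear_hypertree r k T" and "1 \<le> r" "1 \<le> k"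
  shows "k * (r - 1) + 1 \<le> card (verts T)"
proof -
  obtain C where C: "C \<subseteq> edges T" "card (\<Union>C) = k * (r - 1) + 1"
    using hypertree_subtree[OF T \<open>1 \<le> r\<close>, of "k - 1"] \<open>1 \<le> k\<close> by auto
  have "finite (verts T)" "\<Union>C \<subseteq> verts T"
    using T C by (auto simp: linear_hypertree_def hypergraph_def)
  then show ?thesis using C card_mono by metis
qed

section \<open>Steiner systems\<close>

text \<open>Double counting of ordered pairs of distinct vertices: each pair lies in exactly one
  block, and each block holds \<open>r * (r - 1)\<close> of them.\<close>

lemma steiner_card_edges:
  assumes B: "steiner_system2 r m B"
  shows "card (edges B) * (r * (r - 1)) = m * (m - 1)"
proof -
  define P where "P A = {(u, v). u \<in> A \<and> v \<in> A \<and> u \<noteq> v}" for A :: "'a set"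
  have card_P: "card (P A) = card A * (card A - 1)" if "finite A" for A
  proof -
    have "P A = Sigma A (\<lambda>u. A - {u})" by (auto simp: P_def)
    then show ?thesis using that by simp
  qed
  have hyp: "finite (verts B)" "\<And>b. b \<in> edges B \<Longrightarrow> b \<subseteq> verts B"
    and unif: "\<And>b. b \<in> edges B \<Longrightarrow> card b = r" and m: "card (verts B) = m"
    and uniq: "\<And>u v. u \<in> verts B \<Longrightarrow> v \<in> verts B \<Longrightarrow> u \<noteq> v \<Longrightarrow> \<exists>!b. b \<in> edges B \<and> u \<in> b \<and> v \<in> b"
    using B by (auto simp: steiner_system2_def hypergraph_def uniform_hypergraph_def)
  have finE: "finite (edges B)"
    by (rule finite_subset[of _ "Pow (verts B)"]) (use hyp in auto)
  have finb: "finite b" if "b \<in> edges B" for b using hyp that by (meson finite_subset)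
  have finP: "finite (P b)" if "b \<in> edges B" for b
    by (rule finite_subset[of _ "b \<times> b"]) (use finb[OF that] in \<open>auto simp: P_def\<close>)
  have "P (verts B) = (\<Union>b\<in>edges B. P b)"
  proof (intro set_eqI iffI)
    fix p assume "p \<in> P (verts B)"
    then obtain u v where p: "p = (u, v)" "u \<in> verts B" "v \<in> verts B" "u \<noteq> v"
      by (auto simp: P_def)
    then obtain b where "b \<in> edges B" "u \<in> b" "v \<in> b" using ex1_implies_ex[OF uniq] by blast
    with p show "p \<in> (\<Union>b\<in>edges B. P b)" by (auto simp: P_def)
  next
    fix p assume "p \<in> (\<Union>b\<in>edges B. P b)"
    then show "p \<in> P (verts B)" using hyp(2) by (fastforce simp: P_def)
  qed
  also have "card \<dots> = (\<Sum>b\<in>edges B. card (P b))"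
  proof (intro card_UN_disjoint finE ballI impI)
    fix b c assume bc: "b \<in> edges B" "c \<in> edges B" "b \<noteq> c"
    have False if "(u, v) \<in> P b \<inter> P c" for u v
    proof -
      have "u \<in> b \<inter> c" "v \<in> b \<inter> c" "u \<noteq> v" using that by (simp_all add: P_def)
      moreover from this have "u \<in> verts B" "v \<in> verts B" using hyp(2) bc by auto
      ultimately show False using uniq[of u v] bc by blast
    qed
    then show "P b \<inter> P c = {}" by auto
  qed (rule finP)
  also have "\<dots> = (\<Sum>b\<in>edges B. r * (r - 1))"
    using card_P finb unif by (intro sum.cong) auto
  finally show ?thesis using card_P[OF hyp(1)] m by simp
qed

lemma steiner_linear:
  assumes "steiner_system2 r m B" "b \<in> edges B" "c \<in> edges B" "b \<noteq> c"
  shows "card (b \<inter> c) \<le> 1"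
proof -
  have "finite b" using assms by (meson finite_subset hypergraph_def steiner_system2_def)
  moreover have "x = y" if "x \<in> b \<inter> c" "y \<in> b \<inter> c" for x y
    using assms that unfolding steiner_system2_def hypergraph_def by blast
  ultimately show ?thesis using card_le_Suc0_iff_eq[of "b \<inter> c"] by auto
qed

section \<open>Disjoint copies of a Steiner system\<close>

text \<open>The \<open>j\<close>-th copy occupies the interval from \<open>j * t\<close> up to but
  excluding \<open>(j + 1) * t\<close>, so \<open>x div t\<close> is the index of the copy
  containing \<open>x\<close>. The last conclusion says that no hyperedge leaves its copy.\<close>

lemma disjoint_copies:
  assumes B: "steiner_system2 r t B" and "1 \<le> r" "1 \<le> t"
  obtains H :: "nat hypergraph" where "hypergraph H" "uniform_hypergraph r H" "linear_hypergraph H"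
    "card (verts H) = q * t" "card (edges H) = q * card (edges B)"
    "\<And>e x y. e \<in> edges H \<Longrightarrow> x \<in> e \<Longrightarrow> y \<in> e \<Longrightarrow> x div t = y div t"
proof -
  have hyp: "finite (verts B)" "\<And>b. b \<in> edges B \<Longrightarrow> b \<subseteq> verts B"
    and unif: "\<And>b. b \<in> edges B \<Longrightarrow> card b = r" and t: "card (verts B) = t"
    using B by (auto simp: steiner_system2_def hypergraph_def uniform_hypergraph_def)
  obtain h where h: "bij_betw h (verts B) {..<t}"
    using ex_bij_betw_finite_nat[OF hyp(1)] t by (auto simp: atLeast0LessThan)
  have hlt: "h x < t" if "x \<in> verts B" for x using h that by (auto simp: bij_betw_def)
  define c where "c j b = (\<lambda>x. j * t + h x) ` b" for j b
  define E where "E = (\<lambda>(j, b). c j b) ` ({..<q} \<times> edges B)"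
  define H where "H = \<lparr>verts = {..<q * t}, edges = E\<rparr>"
  have cdiv: "z div t = j" if "z \<in> c j b" "b \<in> edges B" for z j b
  proof -
    obtain x where "x \<in> b" "z = j * t + h x" using \<open>z \<in> c j b\<close> by (auto simp: c_def)
    moreover have "h x < t" using hlt hyp(2)[OF that(2)] \<open>x \<in> b\<close> by blast
    ultimately show ?thesis by simp
  qed
  have inj: "inj_on (\<lambda>x. j * t + h x) (verts B)" for j
    using h by (auto simp: bij_betw_def inj_on_def)
  have card_c: "card (c j b) = r" if "b \<in> edges B" for j b
    unfolding c_def using inj hyp(2) unif that by (metis card_image inj_on_subset)
  have c_ne: "c j b \<noteq> {}" if "b \<in> edges B" for j b
    using card_c[OF that, of j] \<open>1 \<le> r\<close> by auto
  have c_inj: "j = j' \<and> b = b'" if "b \<in> edges B" "b' \<in> edges B" "c j b = c j' b'" for j j' b b'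
  proof
    \<comment> \<open>Any vertex of the shifted block reveals its copy through \<open>div t\<close>;
      such a vertex exists because \<open>r\<close> is positive.\<close>
    show "j = j'" using c_ne[of b j] cdiv that by (metis ex_in_conv)
    then show "b = b'"
      using that inj[of j] hyp(2) unfolding c_def by (metis inj_on_image_eq_iff)
  qed
  have card_E: "card E = q * card (edges B)"
    unfolding E_def by (subst card_image) (auto intro!: inj_onI dest: c_inj simp: card_cartesian_product)
  have sub_E: "e \<subseteq> {..<q * t}" if "e \<in> E" for e
  proof
    fix z assume "z \<in> e"
    then obtain j b x where "j < q" "b \<in> edges B" "x \<in> b" "z = j * t + h x"
      using \<open>e \<in> E\<close> by (auto simp: E_def c_def)
    moreover have "h x < t" using hlt hyp(2) \<open>b \<in> edges B\<close> \<open>x \<in> b\<close> by blast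
    moreover have "Suc j * t \<le> q * t" using \<open>j < q\<close> by (intro mult_le_mono1) simp
    ultimately have "z < Suc j * t" "Suc j * t \<le> q * t" by simp_all
    then show "z \<in> {..<q * t}" by simp
  qed
  have lin_E: "card (e \<inter> f) \<le> 1" if ef: "e \<in> E" "f \<in> E" "e \<noteq> f" for e f
  proof -
    obtain j b where e: "b \<in> edges B" "e = c j b" using ef(1) by (auto simp: E_def)
    obtain i b' where f: "b' \<in> edges B" "f = c i b'" using ef(2) by (auto simp: E_def)
    \<comment> \<open>Within one copy linearity is inherited from the Steiner system; different
      copies are disjoint.\<close>
    show ?thesis
    proof (cases "i = j")
      case True
      with e f have "e \<inter> f = c j (b \<inter> b')"
        using inj_on_image_Int[OF inj] hyp(2) by (auto simp: c_def)
      moreover have "card (c j (b \<inter> b')) \<le> card (b \<inter> b')"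
        unfolding c_def using hyp e by (metis card_image_le finite_Int finite_subset)
      moreover have "card (b \<inter> b') \<le> 1"
        using steiner_linear[OF B e(1) f(1)] True ef(3) e f by auto
      ultimately show ?thesis by simp
    next
      case False
      then have "e \<inter> f = {}" using cdiv e f by blast
      then show ?thesis by simp
    qed
  qed
  have div_E: "x div t = y div t" if "e \<in> E" "x \<in> e" "y \<in> e" for e x y
    using that cdiv by (auto simp: E_def)
  have unif_E: "card e = r" if "e \<in> E" for e using that card_c by (auto simp: E_def)
  show ?thesis
  proof (rule that[of H])
    show "hypergraph H" using sub_E by (simp add: H_def hypergraph_def)
    show "uniform_hypergraph r H" using unif_E by (simp add: H_def uniform_hypergraph_def)
    show "linear_hypergraph H" using lin_E by (simp add: H_def linear_hypergraph_def)
    show "card (verts H) = q * t" by (simp add: H_def)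
    show "card (edges H) = q * card (edges B)" using card_E by (simp add: H_def)
    show "x div t = y div t" if "e \<in> edges H" "x \<in> e" "y \<in> e" for e x y
      using div_E[of e x y] that by (simp add: H_def)
  qed
qed

text \<open>Along hyperedges the quotient by \<open>t\<close> is constant, so a connected
  \<open>F\<close> would be mapped injectively into one interval of \<open>t\<close> numbers, which
  is too small.\<close>

lemma connected_not_contained:
  fixes H :: "nat hypergraph"
  assumes conn: "connected_hypergraph F" and big: "t < card (verts F)" and "1 \<le> t"
    and blocks: "\<And>e x y. e \<in> edges H \<Longrightarrow> x \<in> e \<Longrightarrow> y \<in> e \<Longrightarrow> x div t = y div t"
  shows "\<not> contains_hypergraph H F"
proof
  assume "contains_hypergraph H F"
  then obtain \<phi> where inj: "inj_on \<phi> (verts F)" and edge: "\<And>e. e \<in> edges F \<Longrightarrow> \<phi> ` e \<in> edges H"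
    by (auto simp: contains_hypergraph_def)
  obtain u where u: "u \<in> verts F" using big by (metis card.empty ex_in_conv not_less_zero)
  have same: "\<phi> v div t = \<phi> u div t" if "v \<in> verts F" for v
  proof -
    have "(u, v) \<in> (joined (edges F))\<^sup>*"
      using conn u that by (auto simp: connected_hypergraph_joined)
    then show ?thesis
    proof (induction rule: rtrancl_induct)
      case (step y z)
      then obtain e where "e \<in> edges F" "y \<in> e" "z \<in> e" by (auto simp: joined_def)
      then have "\<phi> y div t = \<phi> z div t" using blocks[OF edge] by blast
      with step.IH show ?case by simp
    qed simp
  qed
  have "\<phi> ` verts F \<subseteq> {\<phi> u div t * t..<\<phi> u div t * t + t}"
  proof (intro image_subsetI)
    fix v assume "v \<in> verts F"
    then have "\<phi> v = \<phi> u div t * t + \<phi> v mod t"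
      using same[of v] by (metis div_mult_mod_eq)
    moreover have "\<phi> v mod t < t" using \<open>1 \<le> t\<close> by simp
    ultimately show "\<phi> v \<in> {\<phi> u div t * t..<\<phi> u div t * t + t}"
      by (metis atLeastLessThan_iff le_add1 nat_add_left_cancel_less)
  qed
  then have "card (\<phi> ` verts F) \<le> t"
    using card_mono[of "{\<phi> u div t * t..<\<phi> u div t * t + t}"] by simp
  with card_image[OF inj] big show False by simp
qed

section \<open>Access to the extremal number\<close>

text \<open>A family of subsets of \<open>n\<close> vertices has at most \<open>2 ^ n\<close>
  members. Finiteness gives \<open>Max\<close> in \<open>ex_lin\<close> its intended
  meaning.\<close>

lemma finite_turan_set:
  "finite {card (edges H) | H :: nat hypergraph.
            hypergraph H \<and> uniform_hypergraph r H \<and> linear_hypergraph H \<and> card (verts H) = n \<and>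
            \<not> contains_hypergraph H F}"
proof (rule finite_subset[of _ "{..2 ^ n}"], clarsimp)
  fix H :: "nat hypergraph"
  assume "hypergraph H" "n = card (verts H)"
  then have "finite (verts H)" "edges H \<subseteq> Pow (verts H)" by (auto simp: hypergraph_def)
  then show "card (edges H) \<le> 2 ^ card (verts H)"
    by (metis card_Pow card_mono finite_Pow_iff)
qed simp

text \<open>The copies form an \<open>F\<close>-free host. This bounds the maximum from below and
  also shows that the set under \<open>Max\<close> is nonempty, so that the maximum is attained by
  some hypergraph.\<close>

lemma ex_lin_connected:
  assumes "steiner_system2 r t B" "1 \<le> r" "1 \<le> t" "connected_hypergraph F" "t < card (verts F)"
  shows "q * card (edges B) \<le> ex_lin r (q * t) F"
    and "\<exists>H :: nat hypergraph. hypergraph H \<and> uniform_hypergraph r H \<and> linear_hypergraph H \<and>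
           card (verts H) = q * t \<and> \<not> contains_hypergraph H F \<and> card (edges H) = ex_lin r (q * t) F"
proof -
  obtain H :: "nat hypergraph" where H: "hypergraph H" "uniform_hypergraph r H" "linear_hypergraph H"
    "card (verts H) = q * t" "card (edges H) = q * card (edges B)"
    and blocks: "\<And>e x y. e \<in> edges H \<Longrightarrow> x \<in> e \<Longrightarrow> y \<in> e \<Longrightarrow> x div t = y div t"
    using disjoint_copies[OF assms(1-3)] by blast
  let ?M = "{card (edges H) | H :: nat hypergraph.
            hypergraph H \<and> uniform_hypergraph r H \<and> linear_hypergraph H \<and> card (verts H) = q * t \<and>
            \<not> contains_hypergraph H F}"
  have free: "\<not> contains_hypergraph H F"
    by (rule connected_not_contained[OF assms(4,5,3) blocks])
  have mem: "q * card (edges B) \<in> ?M" using H free by (metis (mono_tags, lifting) mem_Collect_eq)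
  then show "q * card (edges B) \<le> ex_lin r (q * t) F"
    unfolding ex_lin_def by (intro Max_ge finite_turan_set)
  have "ex_lin r (q * t) F \<in> ?M"
    unfolding ex_lin_def using mem by (intro Max_in finite_turan_set) blast
  then show "\<exists>H :: nat hypergraph. hypergraph H \<and> uniform_hypergraph r H \<and> linear_hypergraph H \<and>
           card (verts H) = q * t \<and> \<not> contains_hypergraph H F \<and> card (edges H) = ex_lin r (q * t) F"
    unfolding mem_Collect_eq by metis
qed

section \<open>Stars and the upper bound\<close>

lemma star_imp_hypertree:
  assumes S: "linear_star r k S"
  shows "linear_hypertree r k S"
proof -
  obtain c where *: "\<forall>e\<in>edges S. c \<in> e"
    "\<forall>e\<in>edges S. \<forall>f\<in>edges S. e \<noteq> f \<longrightarrow> e \<inter> f = {c}"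
    using S unfolding linear_star_def by (elim conjE exE) (rule that)
  note c = *(1)[rule_format] and inter = *(2)[rule_format]
  have verts: "verts S = \<Union>(edges S)" using S by (simp add: linear_star_def)
  have "linear_hypergraph S" using inter by (auto simp: linear_hypergraph_def)
  moreover have "connected_hypergraph S"
    unfolding connected_hypergraph_joined
  proof (intro ballI)
    fix u v assume "u \<in> verts S" "v \<in> verts S"
    then have "(u, c) \<in> joined (edges S)" "(c, v) \<in> joined (edges S)"
      using c verts by (auto simp: joined_def)
    then show "(u, v) \<in> (joined (edges S))\<^sup>*"
      by (meson rtrancl.rtrancl_refl rtrancl_into_rtrancl)
  qed
  moreover have "acyclic_hypergraph S"
    unfolding acyclic_hypergraph_def
  proof
    assume "\<exists>es. hypercycle S es"
    then obtain es where len: "3 \<le> length es" and dist: "distinct es" and sub: "set es \<subseteq> edges S"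
      and inj: "inj_on (\<lambda>i. es ! i \<inter> es ! (Suc i mod length es)) {..<length es}"
      by (auto simp: hypercycle_def)
    \<comment> \<open>Two successive intersections among the first three hyperedges already
      coincide, both being \<open>{c}\<close>, which contradicts their distinctness in a
      hypercycle.\<close>
    have "es ! i \<in> edges S" if "i < 3" for i
      using subsetD[OF sub nth_mem[of i es]] len that by simp
    then have "es ! 0 \<in> edges S" "es ! 1 \<in> edges S" "es ! 2 \<in> edges S" by simp_all
    moreover have "es ! 0 \<noteq> es ! 1" "es ! 1 \<noteq> es ! 2"
      using len nth_eq_iff_index_eq[OF dist, of 0 1] nth_eq_iff_index_eq[OF dist, of 1 2]
      by linarith+
    ultimately have "es ! 0 \<inter> es ! 1 = {c}" "es ! 1 \<inter> es ! 2 = {c}"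
      using inter by blast+
    moreover from len have "es \<noteq> []" by auto
    ultimately show False using inj_onD[OF inj, of 0 1] len by (simp add: numeral_2_eq_2)
  qed
  ultimately show ?thesis using S by (auto simp: linear_star_def linear_hypertree_def)
qed

text \<open>Used to map each hyperedge of a star onto a host hyperedge with the centre sent to a
  prescribed vertex.\<close>

lemma ex_bij_betw_point:
  assumes "finite A" "finite B" "card A = card B" "a \<in> A" "b \<in> B"
  shows "\<exists>f. bij_betw f A B \<and> f a = b"
proof -
  have "card (A - {a}) = card (B - {b})" using assms by simp
  then obtain f where f: "bij_betw f (A - {a}) (B - {b})"
    using finite_same_card_bij[of "A - {a}" "B - {b}"] assms by auto
  have "bij_betw (f(a := b)) (A - {a}) (B - {b})"
    using f bij_betw_cong[of "A - {a}" "f(a := b)" f "B - {b}"] by simp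
  then have "bij_betw (f(a := b)) (A - {a} \<union> {a}) (B - {b} \<union> {b})"
    using notIn_Un_bij_betw[of a "A - {a}" "f(a := b)" "B - {b}"] by simp
  moreover have "A - {a} \<union> {a} = A" "B - {b} \<union> {b} = B" using assms by auto
  ultimately show ?thesis by (intro exI[of _ "f(a := b)"]) simp
qed

text \<open>Match the \<open>k\<close> star hyperedges with \<open>k\<close> host hyperedges through
  \<open>v\<close>, and glue bijections that all send \<open>c\<close> to \<open>v\<close>. Gluing
  is consistent because star hyperedges meet only in \<open>c\<close>; it is injective because, by
  linearity, the chosen host hyperedges meet only in \<open>v\<close>.\<close>

lemma contains_star:
  assumes S: "linear_star r k S"
    and hyp: "hypergraph H" and unif: "uniform_hypergraph r H" and lin: "linear_hypergraph H"
    and deg: "k \<le> card {e \<in> edges H. v \<in> e}"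
  shows "contains_hypergraph H S"
proof -
  obtain c where *: "\<forall>e\<in>edges S. c \<in> e"
    "\<forall>e\<in>edges S. \<forall>f\<in>edges S. e \<noteq> f \<longrightarrow> e \<inter> f = {c}"
    using S unfolding linear_star_def by (elim conjE exE) (rule that)
  note c = *(1)[rule_format] and inter = *(2)[rule_format]
  have verts: "verts S = \<Union>(edges S)" and finS: "finite (verts S)" "\<And>e. e \<in> edges S \<Longrightarrow> e \<subseteq> verts S"
    and cardS: "card (edges S) = k" and unifS: "\<And>e. e \<in> edges S \<Longrightarrow> card e = r"
    using S by (auto simp: linear_star_def hypergraph_def uniform_hypergraph_def)
  have finES: "finite (edges S)" by (rule finite_subset[of _ "Pow (verts S)"]) (use finS in auto)
  have finH: "finite e" if "e \<in> edges H" for e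
    using hyp that by (meson finite_subset hypergraph_def)
  obtain D where D: "D \<subseteq> {e \<in> edges H. v \<in> e}" "card D = k" "finite D"
    using obtain_subset_with_card_n[OF deg] by metis
  obtain g where g: "bij_betw g (edges S) D"
    using finite_same_card_bij[OF finES D(3)] D(2) cardS by auto
  have gD: "g e \<in> edges H" "v \<in> g e" if "e \<in> edges S" for e
    using g D that by (auto simp: bij_betw_def)
  have "\<exists>b. bij_betw b e (g e) \<and> b c = v" if "e \<in> edges S" for e
  proof (rule ex_bij_betw_point)
    show "finite e" using finS that by (meson finite_subset)
    show "card e = card (g e)" using gD that unifS unif by (simp add: uniform_hypergraph_def)
  qed (use gD that c finH in auto)
  then have "\<forall>e\<in>edges S. \<exists>b. bij_betw b e (g e) \<and> b c = v" by blast
  from bchoice[OF this] obtain b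
    where b: "\<And>e. e \<in> edges S \<Longrightarrow> bij_betw (b e) e (g e) \<and> b e c = v" by blast
  \<comment> \<open>The choice of hyperedge affects only \<open>c\<close>, and every
    \<open>b e\<close> sends \<open>c\<close> to \<open>v\<close>.\<close>
  define \<phi> where "\<phi> x = b (SOME e. e \<in> edges S \<and> x \<in> e) x" for x
  have \<phi>: "\<phi> x = b e x" if "e \<in> edges S" "x \<in> e" for e x
  proof -
    let ?e = "SOME e. e \<in> edges S \<and> x \<in> e"
    have e': "?e \<in> edges S \<and> x \<in> ?e" 
      using someI[of "\<lambda>e. e \<in> edges S \<and> x \<in> e" e] that by simp
    show ?thesis
    proof (cases "?e = e")
      case False
      then have "x = c" using inter[of ?e e] e' that by blast
      then show ?thesis using b e' that by (simp add: \<phi>_def)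
    qed (simp add: \<phi>_def)
  qed
  have img: "\<phi> ` e = g e" if "e \<in> edges S" for e
  proof -
    have "\<phi> ` e = b e ` e" using \<phi> that by (intro image_cong) auto
    then show ?thesis using b[OF that] by (simp add: bij_betw_def)
  qed
  have center: "x = c" if "e \<in> edges S" "x \<in> e" "\<phi> x = v" for e x
  proof -
    have "b e x = b e c" using that \<phi> b by metis
    then show ?thesis using b[OF that(1)] c that by (meson bij_betw_def inj_onD)
  qed
  have "inj_on \<phi> (verts S)"
  proof (rule inj_onI)
    fix x y assume "x \<in> verts S" "y \<in> verts S" and eq: "\<phi> x = \<phi> y"
    then obtain e f where e: "e \<in> edges S" "x \<in> e" and f: "f \<in> edges S" "y \<in> f"
      using verts by auto
    show "x = y"
    proof (cases "e = f")
      case True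
      then have "b e x = b e y" using \<phi> e f eq by metis
      then show ?thesis using b[OF e(1)] e f True by (meson bij_betw_def inj_onD)
    next
      case False
      \<comment> \<open>The common image lies in both host hyperedges, hence equals
        \<open>v\<close>, and only \<open>c\<close> is sent to \<open>v\<close>.\<close>
      then have "g e \<noteq> g f" using g e f by (meson bij_betw_def inj_onD)
      then have "g e \<inter> g f = {v}"
        using linear_inter_singleton[OF lin _ _ _ finH] gD[OF e(1)] gD[OF f(1)] by simp
      moreover have "\<phi> x \<in> g e \<inter> g f" using img e f eq by (metis IntI imageI)
      ultimately have "\<phi> x = v" "\<phi> y = v" using eq by auto
      then show ?thesis using center e f by metis
    qed
  qed
  moreover have "\<phi> ` verts S \<subseteq> verts H"
  proof (rule image_subsetI)
    fix x assume "x \<in> verts S"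
    then obtain e where e: "e \<in> edges S" "x \<in> e" using verts by auto
    then have "\<phi> x \<in> g e" using img by blast
    then show "\<phi> x \<in> verts H" using gD(1)[OF e(1)] hyp by (auto simp: hypergraph_def)
  qed
  ultimately show ?thesis
    using img gD(1) unfolding contains_hypergraph_def by (intro exI[of _ \<phi>]) simp
qed

text \<open>Count incidences in two ways: each hyperedge contributes \<open>r\<close>, each vertex
  at most \<open>k - 1\<close>.\<close>

lemma star_free_card_edges:
  assumes S: "linear_star r k S"
    and hyp: "hypergraph H" and unif: "uniform_hypergraph r H" and lin: "linear_hypergraph H"
    and free: "\<not> contains_hypergraph H S"
  shows "r * card (edges H) \<le> card (verts H) * (k - 1)"
proof -
  have fin: "finite (verts H)" and sub: "\<And>e. e \<in> edges H \<Longrightarrow> e \<subseteq> verts H"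
    using hyp by (auto simp: hypergraph_def)
  have finE: "finite (edges H)" by (rule finite_subset[of _ "Pow (verts H)"]) (use fin sub in auto)
  have deg: "card {e \<in> edges H. v \<in> e} \<le> k - 1" for v
    using contains_star[OF S hyp unif lin, of v] free by linarith
  have "{v \<in> verts H. v \<in> e} = e" if "e \<in> edges H" for e using sub that by blast
  then have "r * card (edges H) = (\<Sum>e\<in>edges H. card {v \<in> verts H. v \<in> e})"
    using unif by (simp add: uniform_hypergraph_def)
  also have "\<dots> = (\<Sum>v\<in>verts H. card {e \<in> edges H. v \<in> e})"
    using sum_multicount_gen[OF finE fin, of "\<lambda>e v. v \<in> e" "\<lambda>v. card {e \<in> edges H. v \<in> e}"] by simp
  also have "\<dots> \<le> card (verts H) * (k - 1)"
    using sum_bounded_above[of "verts H" "\<lambda>v. card {e \<in> edges H. v \<in> e}" "k - 1"] deg by simp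
  finally show ?thesis .
qed

theorem theorem2:
  fixes r k n t :: nat
  assumes "r \<ge> 3" and "k \<ge> 2"
    and "t = (r - 1) * (k - 1) + 1"
    and "n \<ge> 1" and "t dvd n"
    and "\<exists>B :: 'c hypergraph. steiner_system2 r t B"
  shows "(\<forall>T :: 'a hypergraph. linear_hypertree r k T \<longrightarrow>
            real (ex_lin r n T) \<ge> real n * (real k - 1) / real r) \<and>
         (\<forall>S :: 'b hypergraph. linear_star r k S \<longrightarrow>
            real (ex_lin r n S) = real n * (real k - 1) / real r)"
proof -
  obtain B :: "'c hypergraph" where B: "steiner_system2 r t B" using assms(6) by blast
  obtain q where q: "n = q * t" using assms(5) by (metis dvdE mult.commute)
  have r: "1 \<le> r" and t: "1 \<le> t" using assms by auto
  \<comment> \<open>The pair count with \<open>t - 1 = (r - 1) * (k - 1)\<close> substituted;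
    cancelling \<open>r - 1 > 0\<close> gives the number of blocks.\<close>
  have "(card (edges B) * r) * (r - 1) = (t * (k - 1)) * (r - 1)"
  proof -
    have "t - 1 = (r - 1) * (k - 1)" using assms(3) by simp
    then show ?thesis using steiner_card_edges[OF B] by (simp only: ac_simps)
  qed
  then have "card (edges B) * r = t * (k - 1)" using assms(1) by simp
  then have cardB: "r * (q * card (edges B)) = n * (k - 1)"
    unfolding q by (metis mult.assoc mult.commute)
  have real_k: "real n * (real k - 1) = real (n * (k - 1))" using assms(2) by (simp add: of_nat_diff)
  \<comment> \<open>So a hypertree has at least \<open>t + (r - 1)\<close> vertices, which exceeds
    \<open>t\<close>.\<close>
  have "(r - 1) * (k - 1) + (r - 1) = k * (r - 1)"
    using assms(2) by (cases k) simp_all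
  then have big: "t < k * (r - 1) + 1" using assms(1,3) by linarith
  \<comment> \<open>The fresh type \<open>'d\<close> lets this fact and the next serve both
    hypertrees over \<open>'a\<close> and stars over \<open>'b\<close>.\<close>
  have conn: "connected_hypergraph T" "t < card (verts T)" if "linear_hypertree r k T"
    for T :: "'d hypergraph"
    using that hypertree_card_verts[OF that] big assms(2) r by (auto simp: linear_hypertree_def)
  have lower: "real n * (real k - 1) / real r \<le> real (ex_lin r n T)" if "linear_hypertree r k T"
    for T :: "'d hypergraph"
  proof -
    have "q * card (edges B) \<le> ex_lin r n T"
      unfolding q by (rule ex_lin_connected(1)[OF B r t conn[OF that]])
    then have "n * (k - 1) \<le> r * ex_lin r n T" using cardB by (metis mult_le_mono2)
    then have "real (n * (k - 1)) \<le> real r * real (ex_lin r n T)"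
      by (metis of_nat_le_iff of_nat_mult)
    then show ?thesis unfolding real_k using r by (simp add: divide_le_eq mult.commute)
  qed
  have upper: "real (ex_lin r n S) \<le> real n * (real k - 1) / real r" if S: "linear_star r k S"
    for S :: "'b hypergraph"
  proof -
    \<comment> \<open>Apply the degree bound to a host attaining the maximum.\<close>
    obtain H :: "nat hypergraph" where H: "hypergraph H" "uniform_hypergraph r H"
      "linear_hypergraph H" "card (verts H) = n" "\<not> contains_hypergraph H S"
      "card (edges H) = ex_lin r n S"
      using ex_lin_connected(2)[OF B r t conn[OF star_imp_hypertree[OF S]], of q] q by auto
    have "r * ex_lin r n S \<le> n * (k - 1)"
      using star_free_card_edges[OF S H(1-3,5)] H by simp
    then have "real r * real (ex_lin r n S) \<le> real (n * (k - 1))"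
      by (metis of_nat_le_iff of_nat_mult)
    then show ?thesis unfolding real_k using r by (simp add: le_divide_eq mult.commute)
  qed
  show ?thesis using lower upper star_imp_hypertree by (meson antisym)
qed

end
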